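(* Let $(X,d)$ be an unbounded metric space and let $n\ge 0$ be an integer. The following conditions are equivalent: (a) $\mathrm{asdim}(X,d)\le n$. (b) There is a (Gromov) hyperbolic metric $d_h$ on $X$, coarsely equivalent to $d$, such that $\dim_{NA}(X,d_h)\le n$ and the Gromov boundary $\partial_\infty X$ of $(X,d_h)$ consists of one point. (c) There is a metric $d_1$ on $X$, coarsely equivalent to $d$, such that $\dim_{NA}(X,d_1)\le n$.
   Context: A family of subsets of a metric space is $r$-disjoint if any two points lying in two different members of the family are at distance at least $r$. $\mathrm{asdim}(X)\le n$ (asymptotic dimension of Gromov) means: for every $r>0$ there is a cover $\mathcal{U}=\bigcup_{i=1}^{n+1}\mathcal{U}_i$ of $X$ such that each $\mathcal{U}_i$ is $r$-disjoint and the diameters of elements of $\mathcal{U}$ are uniformly bounded. $\dim_{NA}(X)\le n$ (Nagata-Assouad dimension) means: there is $C>0$ such that for all $r>0$ there is a cover $\mathcal{U}=\bigcup_{i=1}^{n+1}\mathcal{U}_i$ of $X$ such that each $\mathcal{U}_i$ is $r$-disjoint and every element of $\mathcal{U}$ has diameter at most $C r$. Two metrics $d,d'$ on $X$ are coarsely equivalent if for every $R>0$ there is $S>0$ such that, for all $x,y\in X$, $d(x,y)\le R$ implies $d'(x,y)\le S$, and $d'(x,y)\le R$ implies $d(x,y)\le S$. For a metric $\rho$ on $X$ and a base point $x_0\in X$ the Gromov product is $(x|y)=\frac12\left(\rho(x,x_0)+\rho(y,x_0)-\rho(x,y)\right)$. The metric $\rho$ is (Gromov) hyperbolic if there is $\delta\ge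 0$ such that $(x|z)\ge\min((x|y),(y|z))-\delta$ for all $x,y,z\in X$ (geodesicity is not required). The Gromov boundary $\partial_\infty X$ of a hyperbolic space is the set of equivalence classes of sequences $\{x_i\}$ in $X$ with $(x_m|x_k)\to\infty$ as $m,k\to\infty$, where $\{x_i\}$ and $\{y_i\}$ are equivalent if $(x_m|y_m)\to\infty$ as $m\to\infty$. *)

theory Defs
  imports "HOL-Analysis.Analysis"
begin

text \<open>A metric space is a carrier \<open>X\<close> with a distance function \<open>d\<close> satisfying the library
  predicate \<open>Metric_space X d\<close>, so that several metrics on the same set can be compared.\<close>

text \<open>The diameter takes values in the extended nonnegative reals; unlike a real-valued supremum
  it is \<open>\<infinity>\<close>, not an unspecified number, on unbounded sets. The empty set has diameter 0.\<close>

definition mdiam :: "('a \<Rightarrow> 'a \<Rightarrow> real) \<Rightarrow> 'a set \<Rightarrow> ennreal" where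
  "mdiam d A = (SUP x\<in>A. SUP y\<in>A. ennreal (d x y))"

definition r_disjoint :: "('a \<Rightarrow> 'a \<Rightarrow> real) \<Rightarrow> real \<Rightarrow> 'a set set \<Rightarrow> bool" where
  "r_disjoint d r \<U> \<longleftrightarrow>
     (\<forall>A\<in>\<U>. \<forall>B\<in>\<U>. A \<noteq> B \<longrightarrow> (\<forall>x\<in>A. \<forall>y\<in>B. r \<le> d x y))"

text \<open>A cover of \<open>X\<close> by \<open>n + 1\<close> families of subsets of \<open>X\<close>, indexed by \<open>0, \<dots>, n\<close>, each of
  which is \<open>r\<close>-disjoint.\<close>

definition r_disjoint_cover ::
    "'a set \<Rightarrow> ('a \<Rightarrow> 'a \<Rightarrow> real) \<Rightarrow> nat \<Rightarrow> real \<Rightarrow> (nat \<Rightarrow> 'a set set) \<Rightarrow> bool" where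
  "r_disjoint_cover X d n r \<U> \<longleftrightarrow>
     (\<forall>i\<le>n. \<U> i \<subseteq> Pow X \<and> r_disjoint d r (\<U> i)) \<and> \<Union>(\<Union>i\<le>n. \<U> i) = X"

definition asdim_le :: "'a set \<Rightarrow> ('a \<Rightarrow> 'a \<Rightarrow> real) \<Rightarrow> nat \<Rightarrow> bool" where
  "asdim_le X d n \<longleftrightarrow>
     (\<forall>r>0. \<exists>\<U>. r_disjoint_cover X d n r \<U> \<and>
        (\<exists>D::real. \<forall>A\<in>(\<Union>i\<le>n. \<U> i). mdiam d A \<le> ennreal D))"

definition nagata_dim_le :: "'a set \<Rightarrow> ('a \<Rightarrow> 'a \<Rightarrow> real) \<Rightarrow> nat \<Rightarrow> bool" where
  "nagata_dim_le X d n \<longleftrightarrow>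
     (\<exists>C>0. \<forall>r>0. \<exists>\<U>. r_disjoint_cover X d n r \<U> \<and>
        (\<forall>A\<in>(\<Union>i\<le>n. \<U> i). mdiam d A \<le> ennreal (C * r)))"

definition coarsely_equivalent ::
    "'a set \<Rightarrow> ('a \<Rightarrow> 'a \<Rightarrow> real) \<Rightarrow> ('a \<Rightarrow> 'a \<Rightarrow> real) \<Rightarrow> bool" where
  "coarsely_equivalent X d d' \<longleftrightarrow>
     (\<forall>R>0. \<exists>S>0. \<forall>x\<in>X. \<forall>y\<in>X. (d x y \<le> R \<longrightarrow> d' x y \<le> S) \<and> (d' x y \<le> R \<longrightarrow> d x y \<le> S))"

definition gromov_product :: "('a \<Rightarrow> 'a \<Rightarrow> real) \<Rightarrow> 'a \<Rightarrow> 'a \<Rightarrow> 'a \<Rightarrow> real" where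
  "gromov_product \<rho> x0 x y = (\<rho> x x0 + \<rho> y x0 - \<rho> x y) / 2"

text \<open>Hyperbolicity is required at every base point, with \<open>\<delta>\<close> allowed to depend on it. If the
  condition holds at one base point with \<open>\<delta>\<close>, it holds at every base point with \<open>2\<delta>\<close>.\<close>

definition gromov_hyperbolic :: "'a set \<Rightarrow> ('a \<Rightarrow> 'a \<Rightarrow> real) \<Rightarrow> bool" where
  "gromov_hyperbolic X \<rho> \<longleftrightarrow>
     (\<forall>x0\<in>X. \<exists>\<delta>\<ge>0. \<forall>x\<in>X. \<forall>y\<in>X. \<forall>z\<in>X.
        gromov_product \<rho> x0 x z
          \<ge> min (gromov_product \<rho> x0 x y) (gromov_product \<rho> x0 y z) - \<delta>)"

definition gromov_sequences ::
    "'a set \<Rightarrow> ('a \<Rightarrow> 'a \<Rightarrow> real) \<Rightarrow> 'a \<Rightarrow> (nat \<Rightarrow> 'a) set" where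
  "gromov_sequences X \<rho> x0 =
     {s. range s \<subseteq> X \<and>
         filterlim (\<lambda>(m, k). gromov_product \<rho> x0 (s m) (s k)) at_top (sequentially \<times>\<^sub>F sequentially)}"

definition gromov_rel ::
    "'a set \<Rightarrow> ('a \<Rightarrow> 'a \<Rightarrow> real) \<Rightarrow> 'a \<Rightarrow> ((nat \<Rightarrow> 'a) \<times> (nat \<Rightarrow> 'a)) set" where
  "gromov_rel X \<rho> x0 =
     {(s, t). s \<in> gromov_sequences X \<rho> x0 \<and> t \<in> gromov_sequences X \<rho> x0 \<and>
        filterlim (\<lambda>m. gromov_product \<rho> x0 (s m) (t m)) at_top sequentially}"

definition gromov_boundary ::
    "'a set \<Rightarrow> ('a \<Rightarrow> 'a \<Rightarrow> real) \<Rightarrow> 'a \<Rightarrow> (nat \<Rightarrow> 'a) set set" where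
  "gromov_boundary X \<rho> x0 = gromov_sequences X \<rho> x0 // gromov_rel X \<rho> x0"

end

theory Submission
  imports Defs
begin

text \<open>
  For (a) \<open>\<Longrightarrow>\<close> (b), choose scales \<open>r\<^sub>0 < r\<^sub>1 < \<dots>\<close> with \<open>r\<^sub>k\<^sub>+\<^sub>1 \<ge> 2 r\<^sub>k\<close> and so large that
  \<open>X\<close> has an \<open>r\<^sub>k\<close>-disjoint cover by sets of diameter at most \<open>r\<^sub>k\<^sub>+\<^sub>1\<close>, and let \<open>d\<^sub>h x y\<close> count the
  scales needed to reach \<open>d x y\<close>. Doubling gives \<open>d\<^sub>h x z \<le> max (d\<^sub>h x y) (d\<^sub>h y z) + 1\<close>. Such
  a function is a metric since its nonzero values are at least 1; it is hyperbolic, and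
  its Gromov products \<open>(x|y)\<close> are large exactly when \<open>x\<close> and \<open>y\<close> are both far from the base point,
  so that all sequences tending to infinity are equivalent. The \<open>r\<^sub>k\<close>-disjoint cover is
  \<open>(k + 1)\<close>-disjoint for \<open>d\<^sub>h\<close> with diameters at most \<open>k + 2\<close>, a linear control.
\<close>

section \<open>Covers and coarse equivalence\<close>

lemma mdiam_le_iff:
  assumes "D \<ge> 0"
  shows "mdiam d A \<le> ennreal D \<longleftrightarrow> (\<forall>x\<in>A. \<forall>y\<in>A. d x y \<le> D)"
  using assms by (auto simp: mdiam_def SUP_le_iff ennreal_le_iff)

lemma r_disjoint_mono:
  assumes "r_disjoint d r \<U>" "\<U> \<subseteq> Pow X"
    and "\<And>x y. x \<in> X \<Longrightarrow> y \<in> X \<Longrightarrow> r \<le> d x y \<Longrightarrow> s \<le> d' x y"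
  shows "r_disjoint d' s \<U>"
  using assms unfolding r_disjoint_def by (meson PowD subsetD)

lemma r_disjoint_cover_mono:
  assumes "r_disjoint_cover X d n r \<U>"
    and "\<And>x y. x \<in> X \<Longrightarrow> y \<in> X \<Longrightarrow> r \<le> d x y \<Longrightarrow> s \<le> d' x y"
  shows "r_disjoint_cover X d' n s \<U>"
proof -
  have "r_disjoint d' s (\<U> i)" if "i \<le> n" for i
    using r_disjoint_mono[of d r "\<U> i" X s d'] assms that
    by (simp add: r_disjoint_cover_def)
  then show ?thesis
    using assms(1) by (simp add: r_disjoint_cover_def)
qed

lemma asdim_leE:
  assumes "asdim_le X d n" "r > 0"
  obtains \<U> D where "r_disjoint_cover X d n r \<U>"
    and "\<And>A x y. A \<in> (\<Union>i\<le>n. \<U> i) \<Longrightarrow> x \<in> A \<Longrightarrow> y \<in> A \<Longrightarrow> d x y \<le> D"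
proof -
  obtain \<U> D where U: "r_disjoint_cover X d n r \<U>"
    and D: "\<forall>A\<in>(\<Union>i\<le>n. \<U> i). mdiam d A \<le> ennreal D"
    using assms unfolding asdim_le_def by blast
  \<comment> \<open>For negative \<open>D\<close> the value \<open>ennreal D\<close> is 0, so the
    real bound it encodes is \<open>max 0 D\<close>.\<close>
  have "d x y \<le> max 0 D" if "A \<in> (\<Union>i\<le>n. \<U> i)" "x \<in> A" "y \<in> A" for A x y
  proof -
    have "mdiam d A \<le> ennreal (max 0 D)"
      using D that(1) by (metis ennreal_leI max.cobounded2 order_trans)
    then show ?thesis
      using that(2,3) by (simp add: mdiam_le_iff)
  qed
  with U show ?thesis by (rule that)
qed

lemma nagata_dim_le_imp_asdim_le:
  assumes "nagata_dim_le X d n"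
  shows "asdim_le X d n"
  using assms unfolding nagata_dim_le_def asdim_le_def by meson

lemma coarsely_equivalent_sym:
  "coarsely_equivalent X d d' \<Longrightarrow> coarsely_equivalent X d' d"
  unfolding coarsely_equivalent_def by meson

text \<open>One direction of coarse equivalence, read contrapositively, carries disjointness over to
  \<open>d'\<close>; the other carries over the diameter bound.\<close>

lemma asdim_le_coarse_invariant:
  assumes "asdim_le X d n" and ce: "coarsely_equivalent X d d'"
  shows "asdim_le X d' n"
  unfolding asdim_le_def
proof (intro allI impI)
  fix r :: real assume "r > 0"
  then obtain S where S: "S > 0" "\<And>x y. x \<in> X \<Longrightarrow> y \<in> X \<Longrightarrow> d' x y \<le> r \<Longrightarrow> d x y \<le> S"
    using ce unfolding coarsely_equivalent_def by meson
  \<comment> \<open>Only \<open>d x y > S\<close> forces \<open>d' x y > r\<close>, while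
    disjointness is a non-strict bound; hence \<open>S + 1\<close>.\<close>
  obtain \<U> D where U: "r_disjoint_cover X d n (S + 1) \<U>"
    and D: "\<And>A x y. A \<in> (\<Union>i\<le>n. \<U> i) \<Longrightarrow> x \<in> A \<Longrightarrow> y \<in> A \<Longrightarrow> d x y \<le> D"
    using asdim_leE[OF assms(1), of "S + 1"] S(1) by auto
  have "max D 1 > 0" by simp
  then obtain T where T: "T > 0"
    "\<And>x y. x \<in> X \<Longrightarrow> y \<in> X \<Longrightarrow> d x y \<le> max D 1 \<Longrightarrow> d' x y \<le> T"
    using ce unfolding coarsely_equivalent_def by meson
  have "r_disjoint_cover X d' n r \<U>"
    using U
  proof (rule r_disjoint_cover_mono)
    fix x y assume "x \<in> X" "y \<in> X" "S + 1 \<le> d x y"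
    then show "r \<le> d' x y" using S(2)[of x y] by linarith
  qed
  moreover have "mdiam d' A \<le> ennreal T" if A: "A \<in> (\<Union>i\<le>n. \<U> i)" for A
  proof -
    have "A \<subseteq> X" using U A unfolding r_disjoint_cover_def by blast
    moreover have "d x y \<le> max D 1" if "x \<in> A" "y \<in> A" for x y
      using D[OF A that] by simp
    ultimately show ?thesis
      using T by (simp add: mdiam_le_iff subset_iff)
  qed
  ultimately show "\<exists>\<U>. r_disjoint_cover X d' n r \<U> \<and>
      (\<exists>D. \<forall>A\<in>(\<Union>i\<le>n. \<U> i). mdiam d' A \<le> ennreal D)"
    by blast
qed

section \<open>Ultrametrics up to an additive constant\<close>

locale near_ultrametric = Metric_space X \<rho>
  for X :: "'a set" and \<rho> :: "'a \<Rightarrow> 'a \<Rightarrow> real" +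
  fixes c :: real
  assumes near_ultra:
    "x \<in> X \<Longrightarrow> y \<in> X \<Longrightarrow> z \<in> X \<Longrightarrow> \<rho> x z \<le> max (\<rho> x y) (\<rho> y z) + c"
begin

lemma const_nonneg:
  assumes "x \<in> X" shows "0 \<le> c"
  using near_ultra[of x x x] assms by simp

lemma hyperbolic: "gromov_hyperbolic X \<rho>"
  unfolding gromov_hyperbolic_def
proof
  fix w assume w: "w \<in> X"
  have "gromov_product \<rho> w x z \<ge> min (gromov_product \<rho> w x y) (gromov_product \<rho> w y z) - 2 * c"
    if "x \<in> X" "y \<in> X" "z \<in> X" for x y z
  proof -
    \<comment> \<open>The four-point form of hyperbolicity. If, say, \<open>\<rho> x y\<close> is
      the largest of the four distances on the right, then up to \<open>c\<close> either
      \<open>\<rho> x z\<close> or \<open>\<rho> y w\<close> is at most \<open>\<rho> z w\<close>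
      and the other at most \<open>\<rho> x y\<close>, or they are at most \<open>\<rho> x w\<close>
      and \<open>\<rho> y z\<close>.\<close>
    have "\<rho> x z + \<rho> y w \<le> max (\<rho> z w + \<rho> x y) (\<rho> x w + \<rho> y z) + 2 * c"
      using near_ultra[of x y z] near_ultra[of x w z] near_ultra[of y x w] near_ultra[of y z w]
        near_ultra[of x w y] near_ultra[of y w z] const_nonneg[OF w] that w
        commute[of x y] commute[of y z] commute[of x z] commute[of x w] commute[of y w] commute[of z w]
      by (smt (verit))
    then show ?thesis
      using const_nonneg[OF w] unfolding gromov_product_def
      by (simp add: min_def max_def field_simps split: if_splits)
  qed
  then show "\<exists>\<delta>\<ge>0. \<forall>x\<in>X. \<forall>y\<in>X. \<forall>z\<in>X. gromov_product \<rho> w x z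
      \<ge> min (gromov_product \<rho> w x y) (gromov_product \<rho> w y z) - \<delta>"
    using const_nonneg[OF w] by (intro exI[of _ "2 * c"]) auto
qed

text \<open>A sum of two numbers minus their maximum is their minimum. So distance from the base
  point alone makes Gromov products large.\<close>

lemma gromov_product_ge:
  assumes "x \<in> X" "y \<in> X" "w \<in> X"
  shows "gromov_product \<rho> w x y \<ge> (min (\<rho> x w) (\<rho> y w) - c) / 2"
  using near_ultra[of x w y] assms commute[of y w] unfolding gromov_product_def by auto

text \<open>The filter is arbitrary so as to serve both the double limit defining Gromov sequences
  and the single limit defining their equivalence.\<close>

lemma filterlim_gromov_product:
  assumes "\<And>i. f i \<in> X" "\<And>i. g i \<in> X" "w \<in> X"
    and f: "filterlim (\<lambda>i. \<rho> (f i) w) at_top F" and g: "filterlim (\<lambda>i. \<rho> (g i) w) at_top F"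
  shows "filterlim (\<lambda>i. gromov_product \<rho> w (f i) (g i)) at_top F"
  unfolding filterlim_at_top
proof
  fix Z :: real
  have "\<forall>\<^sub>F i in F. 2 * Z + c \<le> \<rho> (f i) w" "\<forall>\<^sub>F i in F. 2 * Z + c \<le> \<rho> (g i) w"
    using f g unfolding filterlim_at_top by auto
  then show "\<forall>\<^sub>F i in F. Z \<le> gromov_product \<rho> w (f i) (g i)"
  proof eventually_elim
    case (elim i)
    then show ?case using gromov_product_ge[of "f i" "g i" w] assms(1-3) by auto
  qed
qed

text \<open>Forwards, restrict the double limit to the diagonal, where \<open>(x|x)\<close> is the
  distance to the base point. Backwards, use the lower bound on Gromov products.\<close>

lemma gromov_sequences_iff:
  assumes "w \<in> X"
  shows "s \<in> gromov_sequences X \<rho> w \<longleftrightarrow>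
    range s \<subseteq> X \<and> filterlim (\<lambda>m. \<rho> (s m) w) at_top sequentially"
proof (intro iffI conjI)
  assume s: "s \<in> gromov_sequences X \<rho> w"
  then show range: "range s \<subseteq> X" by (simp add: gromov_sequences_def)
  have "filterlim (\<lambda>m. (m, m)) (sequentially \<times>\<^sub>F sequentially) sequentially"
    by (intro filterlim_Pair filterlim_ident)
  then have "filterlim (\<lambda>m. gromov_product \<rho> w (s m) (s m)) at_top sequentially"
    using s filterlim_compose[of "\<lambda>(m, k). gromov_product \<rho> w (s m) (s k)"]
    unfolding gromov_sequences_def by fastforce
  moreover have "gromov_product \<rho> w (s m) (s m) = \<rho> (s m) w" for m
    using range mdist_zero[of "s m"] by (auto simp: gromov_product_def image_subset_iff)
  ultimately show "filterlim (\<lambda>m. \<rho> (s m) w) at_top sequentially" by simp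
next
  assume s: "range s \<subseteq> X \<and> filterlim (\<lambda>m. \<rho> (s m) w) at_top sequentially"
  have "filterlim (\<lambda>i. gromov_product \<rho> w (s (fst i)) (s (snd i))) at_top
      (sequentially \<times>\<^sub>F sequentially)"
  proof (rule filterlim_gromov_product)
    show "filterlim (\<lambda>i. \<rho> (s (fst i)) w) at_top (sequentially \<times>\<^sub>F sequentially)"
      using filterlim_compose[OF conjunct2[OF s] filterlim_fst] .
    show "filterlim (\<lambda>i. \<rho> (s (snd i)) w) at_top (sequentially \<times>\<^sub>F sequentially)"
      using filterlim_compose[OF conjunct2[OF s] filterlim_snd] .
  qed (use s assms in auto)
  then show "s \<in> gromov_sequences X \<rho> w"
    using s by (simp add: gromov_sequences_def case_prod_beta')
qed

text \<open>Any two Gromov sequences are equivalent, so there is at most one class; unboundedness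
  supplies a sequence tending to infinity, hence a class.\<close>

lemma boundary_singleton:
  assumes "\<not> mbounded X" "w \<in> X"
  shows "is_singleton (gromov_boundary X \<rho> w)"
proof -
  let ?S = "gromov_sequences X \<rho> w"
  have rel: "gromov_rel X \<rho> w = ?S \<times> ?S"
    using assms(2)
    by (auto simp: gromov_rel_def gromov_sequences_iff image_subset_iff intro!: filterlim_gromov_product)
  have "\<exists>x\<in>X. real m \<le> \<rho> x w" for m
  proof (rule ccontr)
    assume "\<not> ?thesis"
    then have "X \<subseteq> mcball w (real m)"
      using assms(2) commute by (metis in_mcball le_cases subsetI)
    with assms(1) show False by (auto simp: mbounded_def)
  qed
  then obtain s where s: "\<And>m. s m \<in> X" "\<And>m. real m \<le> \<rho> (s m) w" by metis
  have "filterlim (\<lambda>m. \<rho> (s m) w) at_top sequentially"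
    using s(2) by (intro filterlim_at_top_mono[OF filterlim_real_sequentially]) auto
  then have "s \<in> ?S" using s(1) assms(2) by (auto simp: gromov_sequences_iff)
  then have "gromov_boundary X \<rho> w = {?S}"
    unfolding gromov_boundary_def quotient_def rel by auto
  then show ?thesis by (simp add: is_singleton_def)
qed

end

section \<open>Counting scales\<close>

locale doubling_scales =
  fixes r :: "nat \<Rightarrow> real"
  assumes r_0: "1 \<le> r 0" and r_Suc: "2 * r k \<le> r (Suc k)"
begin

text \<open>The \<open>Suc\<close> reserves the value 0 for distance 0, so that distinct points have
  level at least 1.\<close>

definition level :: "real \<Rightarrow> nat" where
  "level t = (if t \<le> 0 then 0 else Suc (LEAST k. t \<le> r k))"

lemma r_ge_power: "2 ^ k \<le> r k"
proof (induction k)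
  case (Suc k)
  then show ?case using r_Suc[of k] by simp
qed (simp add: r_0)

lemma r_pos: "0 < r k"
  using r_ge_power[of k] by (smt (verit) zero_less_power)

lemma r_strict_mono: "strict_mono r"
  unfolding strict_mono_Suc_iff using r_Suc r_pos by (smt (verit))

lemma exists_scale: "\<exists>k. t \<le> r k"
  using real_arch_pow[of 2 t] r_ge_power by (meson less_imp_le one_less_numeral_iff
      order_trans semiring_norm(76))

text \<open>The scales increase to infinity, so the least one above \<open>t\<close> exists and is
  at most \<open>r k\<close> exactly when \<open>t\<close> is. With \<open>level_eq_0_iff\<close>
  this replaces the definition from here on.\<close>

lemma level_le_Suc_iff: "level t \<le> Suc k \<longleftrightarrow> t \<le> r k"
proof (cases "t \<le> 0")
  case True
  then show ?thesis using r_pos[of k] by (simp add: level_def)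
next
  case False
  have "(LEAST k. t \<le> r k) \<le> k \<longleftrightarrow> t \<le> r k"
    using LeastI_ex[OF exists_scale[of t]] strict_mono_mono[OF r_strict_mono]
    by (meson Least_le monoD order_trans)
  with False show ?thesis by (simp add: level_def)
qed

lemma level_eq_0_iff: "level t = 0 \<longleftrightarrow> t \<le> 0"
  by (simp add: level_def)

text \<open>Equality \<open>t = r k\<close> is included because \<open>t\<close> is compared with
  the preceding, strictly smaller scale. This turns \<open>r k\<close>-disjoint families into
  \<open>(k + 1)\<close>-disjoint ones.\<close>

lemma level_gt_if_scale_le:
  assumes "r k \<le> t" shows "k < level t"
proof (cases k)
  case 0
  then show ?thesis using assms r_pos[of 0] level_eq_0_iff[of t] by simp
next
  case (Suc j)
  then have "r j < t" using assms r_strict_mono by (meson lessI less_le_trans strict_monoD)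
  with Suc show ?thesis using level_le_Suc_iff[of t j] by simp
qed

text \<open>If \<open>u\<close> and \<open>v\<close> are at most \<open>r k\<close>, then
  \<open>t\<close> is at most \<open>2 * r k\<close>, hence at most the next scale.\<close>

lemma level_triangle:
  assumes "t \<le> u + v"
  shows "level t \<le> Suc (max (level u) (level v))"
proof (cases "max (level u) (level v)")
  case 0
  then show ?thesis using assms level_eq_0_iff[of t] level_eq_0_iff[of u] level_eq_0_iff[of v]
    by simp
next
  case (Suc k)
  then have "level u \<le> Suc k" "level v \<le> Suc k" by (metis max.cobounded1 max.cobounded2)+
  then have "t \<le> r (Suc k)"
    using assms r_Suc[of k] by (simp add: level_le_Suc_iff)
  with Suc show ?thesis by (simp add: level_le_Suc_iff)
qed

lemma near_ultrametric_level:
  assumes "Metric_space X d"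
  shows "near_ultrametric X (\<lambda>x y. real (level (d x y))) 1"
proof -
  interpret Metric_space X d by fact
  have ultra: "level (d x z) \<le> Suc (max (level (d x y)) (level (d y z)))"
    if "x \<in> X" "y \<in> X" "z \<in> X" for x y z
    using triangle[OF that] by (rule level_triangle)
  have zero: "level (d x y) = 0 \<longleftrightarrow> x = y" if "x \<in> X" "y \<in> X" for x y
    using zero[OF that] nonneg[of x y] by (metis level_eq_0_iff order_antisym order_refl)
  show ?thesis
  proof
    fix x y z assume xyz: "x \<in> X" "y \<in> X" "z \<in> X"
    \<comment> \<open>If neither pair coincides, both levels are at least 1, so their sum is at
      least their maximum plus 1.\<close>
    have "level (d x z) \<le> level (d x y) + level (d y z)"
      using ultra[OF xyz] zero[OF xyz(1,2)] zero[OF xyz(2,3)]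
      by (cases "x = y \<or> y = z") auto
    then show "real (level (d x z)) \<le> real (level (d x y)) + real (level (d y z))"
      by linarith
    show "real (level (d x z)) \<le> max (real (level (d x y))) (real (level (d y z))) + 1"
      using ultra[OF xyz] by (simp add: max_def split: if_splits)
  qed (auto simp: commute zero)
qed

lemma coarsely_equivalent_level: "coarsely_equivalent X d (\<lambda>x y. real (level (d x y)))"
  unfolding coarsely_equivalent_def
proof (intro allI impI)
  fix R :: real assume "R > 0"
  obtain j where j: "R \<le> r j" using exists_scale by blast
  obtain k where k: "R \<le> real k" using real_arch_simple by blast
  \<comment> \<open>\<open>r k\<close> bounds distances of level at most \<open>R\<close>;
    \<open>Suc j\<close> bounds levels of distances at most \<open>R\<close>.\<close>
  let ?S = "max (r k) (Suc j)"
  have "real (level t) \<le> ?S" if "t \<le> R" for t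
  proof -
    have "level t \<le> Suc j" using that j by (simp add: level_le_Suc_iff)
    then show ?thesis by linarith
  qed
  moreover have "t \<le> ?S" if "real (level t) \<le> R" for t
  proof -
    have "level t \<le> Suc k" using that k by linarith
    then show ?thesis by (simp add: level_le_Suc_iff)
  qed
  moreover have "?S > 0" by (simp add: max_def r_pos)
  ultimately show "\<exists>S>0. \<forall>x\<in>X. \<forall>y\<in>X. (d x y \<le> R \<longrightarrow> real (level (d x y)) \<le> S)
      \<and> (real (level (d x y)) \<le> R \<longrightarrow> d x y \<le> S)"
    by blast
qed

lemma nagata_dim_le_level:
  assumes "Metric_space X d"
    and U: "\<And>k. r_disjoint_cover X d n (r k) (U k)"
    and diam: "\<And>k A x y. A \<in> (\<Union>i\<le>n. U k i) \<Longrightarrow> x \<in> A \<Longrightarrow> y \<in> A \<Longrightarrow> d x y \<le> r (Suc k)"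
  shows "nagata_dim_le X (\<lambda>x y. real (level (d x y))) n" (is "nagata_dim_le X ?\<rho> n")
  unfolding nagata_dim_le_def
\<comment> \<open>For \<open>s > 1\<close> the cover at scale \<open>k\<close>, the integer part of
  \<open>s\<close>, has diameters at most \<open>k + 2\<close>, which is at most
  \<open>3 * s\<close>.\<close>
proof (rule exI[of _ 3], intro conjI allI impI)
  interpret near_ultrametric X ?\<rho> 1
    using assms(1) by (rule near_ultrametric_level)
  fix s :: real assume "s > 0"
  show "\<exists>\<U>. r_disjoint_cover X ?\<rho> n s \<U> \<and> (\<forall>A\<in>(\<Union>i\<le>n. \<U> i). mdiam ?\<rho> A \<le> ennreal (3 * s))"
  proof (cases "s \<le> 1")
    \<comment> \<open>No multiple of a small \<open>s\<close> bounds \<open>k + 2\<close>, but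
      singletons work, since distinct points are at distance at least 1.\<close>
    case True
    have "s \<le> ?\<rho> x y" if "x \<in> X" "y \<in> X" "x \<noteq> y" for x y
    proof -
      have "level (d x y) \<noteq> 0" using zero[OF that(1,2)] that(3) by simp
      then show ?thesis using True by linarith
    qed
    then have "r_disjoint_cover X ?\<rho> n s (\<lambda>i. (\<lambda>x. {x}) ` X)"
      by (auto simp: r_disjoint_cover_def r_disjoint_def)
    moreover have "mdiam ?\<rho> A \<le> ennreal (3 * s)" if "A \<in> (\<lambda>x. {x}) ` X" for A
      using that \<open>s > 0\<close> mdist_zero by (auto simp: mdiam_le_iff)
    ultimately show ?thesis by (intro exI[of _ "\<lambda>i. (\<lambda>x. {x}) ` X"]) auto
  next
    case False
    define k where "k = nat \<lfloor>s\<rfloor>"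
    have k: "real k \<le> s" "s \<le> real (Suc k)"
      using \<open>s > 0\<close> unfolding k_def by linarith+
    have "r_disjoint_cover X ?\<rho> n s (U k)"
      using U
    proof (rule r_disjoint_cover_mono)
      fix x y assume "r k \<le> d x y"
      then have "Suc k \<le> level (d x y)" by (simp add: level_gt_if_scale_le Suc_leI)
      then show "s \<le> ?\<rho> x y" using k(2) by linarith
    qed
    moreover have "mdiam ?\<rho> A \<le> ennreal (3 * s)" if A: "A \<in> (\<Union>i\<le>n. U k i)" for A
    proof -
      have "?\<rho> x y \<le> 3 * s" if "x \<in> A" "y \<in> A" for x y
      proof -
        have "level (d x y) \<le> Suc (Suc k)"
          using diam[OF A that] by (simp add: level_le_Suc_iff)
        then show ?thesis using k(1) False by linarith
      qed
      then show ?thesis using \<open>s > 0\<close> by (simp add: mdiam_le_iff)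
    qed
    ultimately show ?thesis by blast
  qed
qed simp

end

section \<open>Choice of scales and conclusion\<close>

lemma asdim_le_scales:
  assumes "asdim_le X d n"
  obtains r U where "doubling_scales r"
    and "\<And>k. r_disjoint_cover X d n (r k) (U k)"
    and "\<And>k A x y. A \<in> (\<Union>i\<le>n. U k i) \<Longrightarrow> x \<in> A \<Longrightarrow> y \<in> A \<Longrightarrow> d x y \<le> r (Suc k)"
proof -
  \<comment> \<open>With \<open>t > 0\<close> inside the existential, choice yields total functions
    \<open>V\<close> and \<open>D\<close>, over which the scales can be defined by plain
    recursion.\<close>
  have "\<forall>t. \<exists>\<U> D. t > 0 \<longrightarrow> r_disjoint_cover X d n t \<U> \<and>
      (\<forall>A\<in>(\<Union>i\<le>n. \<U> i). \<forall>x\<in>A. \<forall>y\<in>A. d x y \<le> D)"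
    using asdim_leE[OF assms] by metis
  then obtain V D where V: "\<And>t. t > 0 \<Longrightarrow> r_disjoint_cover X d n t (V t)"
    and D: "\<And>t A x y. t > 0 \<Longrightarrow> A \<in> (\<Union>i\<le>n. V t i) \<Longrightarrow> x \<in> A \<Longrightarrow> y \<in> A \<Longrightarrow> d x y \<le> D t"
    by metis
  \<comment> \<open>Each new scale at least doubles the last and exceeds or equals the diameter
    bound of the cover chosen there.\<close>
  define r where "r = rec_nat 1 (\<lambda>_ t. max (2 * t) (D t))"
  have r: "r 0 = 1" "\<And>k. r (Suc k) = max (2 * r k) (D (r k))"
    by (simp_all add: r_def)
  interpret doubling_scales r
    by standard (simp_all add: r)
  show ?thesis
  proof (rule that[of r "\<lambda>k. V (r k)"])
    show "doubling_scales r" by (rule doubling_scales_axioms)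
    show "r_disjoint_cover X d n (r k) (V (r k))" for k
      using V r_pos by blast
    show "d x y \<le> r (Suc k)" if "A \<in> (\<Union>i\<le>n. V (r k) i)" "x \<in> A" "y \<in> A" for k A x y
      using D[OF r_pos that] by (simp add: r)
  qed
qed

text \<open>Used contrapositively: unboundedness of \<open>d\<close> passes to the level metric,
  whose boundary is then nonempty.\<close>

lemma coarsely_equivalent_mbounded:
  assumes "Metric_space X d" "Metric_space X d'" "coarsely_equivalent X d d'"
    and "Metric_space.mbounded X d' X"
  shows "Metric_space.mbounded X d X"
proof -
  interpret d: Metric_space X d by fact
  interpret d': Metric_space X d' by fact
  obtain B where B: "B > 0" "\<And>x y. x \<in> X \<Longrightarrow> y \<in> X \<Longrightarrow> d' x y \<le> B"
    using assms(4) d'.mbounded_alt_pos by auto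
  then obtain S where "\<And>x y. x \<in> X \<Longrightarrow> y \<in> X \<Longrightarrow> d x y \<le> S"
    using assms(3) unfolding coarsely_equivalent_def by meson
  then show ?thesis using d.mbounded_alt by blast
qed

theorem theorem5p1:
  fixes X :: "'a set" and d :: "'a \<Rightarrow> 'a \<Rightarrow> real" and n :: nat
  assumes "Metric_space X d"
    and "\<not> Metric_space.mbounded X d X"
  defines "cond_a \<equiv> asdim_le X d n"
    and "cond_b \<equiv> (\<exists>d\<^sub>h. Metric_space X d\<^sub>h \<and> gromov_hyperbolic X d\<^sub>h \<and> coarsely_equivalent X d d\<^sub>h
           \<and> nagata_dim_le X d\<^sub>h n \<and> (\<forall>x0\<in>X. is_singleton (gromov_boundary X d\<^sub>h x0)))"
    and "cond_c \<equiv> (\<exists>d\<^sub>1. Metric_space X d\<^sub>1 \<and> coarsely_equivalent X d d\<^sub>1 \<and> nagata_dim_le X d\<^sub>1 n)"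
  shows "(cond_a \<longleftrightarrow> cond_b) \<and> (cond_b \<longleftrightarrow> cond_c)"
proof -
  have a_imp_b: cond_b if a: "asdim_le X d n"
  proof -
    obtain r U where "doubling_scales r"
      and U: "\<And>k. r_disjoint_cover X d n (r k) (U k)"
      and diam: "\<And>k A x y. A \<in> (\<Union>i\<le>n. U k i) \<Longrightarrow> x \<in> A \<Longrightarrow> y \<in> A \<Longrightarrow> d x y \<le> r (Suc k)"
      using asdim_le_scales[OF a] by blast
    interpret doubling_scales r by fact
    let ?\<rho> = "\<lambda>x y. real (level (d x y))"
    interpret \<rho>: near_ultrametric X ?\<rho> 1
      using assms(1) by (rule near_ultrametric_level)
    have "\<not> \<rho>.mbounded X"
      using coarsely_equivalent_mbounded[OF assms(1) \<rho>.Metric_space_axioms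
          coarsely_equivalent_level] assms(2) by blast
    then show cond_b
      unfolding cond_b_def
      using \<rho>.Metric_space_axioms \<rho>.hyperbolic coarsely_equivalent_level[of X d]
        nagata_dim_le_level[OF assms(1) U diam] \<rho>.boundary_singleton
      by (intro exI[of _ ?\<rho>]) auto
  qed
  have b_imp_c: cond_c if cond_b
    using that unfolding cond_b_def cond_c_def by blast
  \<comment> \<open>At each fixed scale a linear diameter bound is a uniform one; coarse invariance
    then carries the bound on asymptotic dimension from \<open>d\<^sub>1\<close> back to
    \<open>d\<close>.\<close>
  have c_imp_a: cond_a if cond_c
    using that asdim_le_coarse_invariant coarsely_equivalent_sym nagata_dim_le_imp_asdim_le
    unfolding cond_a_def cond_c_def by blast
  show ?thesis
    using a_imp_b b_imp_c c_imp_a unfolding cond_a_def by blast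
qed

end
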